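(* Let $(p_n)_{n\ge 0}$ be the sequence defined by $p_0=1$, $p_1=0$ and $$p_{n+1}=(2n+1)p_n+p_{n-1}\qquad (n\ge 1).$$ Then for every $n\ge 0$, $p_n$ equals the number of ordered Carlitz words of $1^2,2^2,\ldots,n^2$.
   Context: A word of $1^k,2^k,\ldots,n^k$ is a sequence of length $kn$ in which each of the symbols $1,\ldots,n$ occurs exactly $k$ times (a multipermutation). It is Carlitz if no two adjacent entries are equal. It is ordered if the first occurrences of the symbols $1,2,\ldots,n$ appear in increasing order from left to right (i.e. the first occurrence of $i$ precedes the first occurrence of $i+1$). For $n=0$ the empty word is the unique such word. *)

theory Defs
  imports Main
begin

definition multiperm_words :: "nat \<Rightarrow> nat \<Rightarrow> nat list set" where
  "multiperm_words k n =
     {w. length w = k * n \<and> set w \<subseteq> {1..n} \<and> (\<forall>i\<in>{1..n}. count_list w i = k)}"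

definition first_occ :: "nat list \<Rightarrow> nat \<Rightarrow> nat" where
  "first_occ w i = (LEAST j. j < length w \<and> w ! j = i)"

text \<open>Only meaningful when each of the symbols \<open>1, \<dots>, n\<close> occurs in \<open>w\<close>, since otherwise
  \<^const>\<open>first_occ\<close> is unspecified.\<close>

definition ordered_word :: "nat \<Rightarrow> nat list \<Rightarrow> bool" where
  "ordered_word n w \<longleftrightarrow> (\<forall>i. 1 \<le> i \<and> i < n \<longrightarrow> first_occ w i < first_occ w (i + 1))"

text \<open>The Carlitz condition (no two adjacent entries are equal) is \<^const>\<open>distinct_adj\<close>.\<close>

definition ordered_carlitz_words :: "nat \<Rightarrow> nat \<Rightarrow> nat list set" where
  "ordered_carlitz_words k n = {w \<in> multiperm_words k n. distinct_adj w \<and> ordered_word n w}"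

lemma finite_ordered_carlitz_words: "finite (ordered_carlitz_words k n)"
proof (rule finite_subset)
  show "ordered_carlitz_words k n \<subseteq> {w. set w \<subseteq> {1..n} \<and> length w = k * n}"
    by (auto simp: ordered_carlitz_words_def multiperm_words_def)
  show "finite {w. set w \<subseteq> {1..n} \<and> length w = k * n}"
    by (rule finite_lists_length_eq) simp
qed

end

theory Submission
  imports Defs
begin

text \<open>
  Write \<open>c\<^sub>n\<close> for the number of ordered Carlitz words of \<open>1\<^sup>2, \<dots>, n\<^sup>2\<close>, and let \<open>s\<^sub>n\<close> count the ways
  to cut an ordered word into two Carlitz pieces \<open>u\<close>, \<open>v\<close>; the word itself need not be Carlitz.
  Inserting a new smallest letter in front and at the cut gives a Carlitz word unless \<open>u\<close> is empty,
  which leaves \<open>c\<^sub>n\<close> choices of \<open>v\<close>, and every ordered Carlitz word on \<open>n + 1\<close> symbols arises once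
  in this way; hence \<open>s\<^sub>n = c\<^sub>n + c\<^sub>n\<^sub>+\<^sub>1\<close>. On the other hand, a cut counted by \<open>s\<^sub>n\<^sub>+\<^sub>1\<close> is either one
  of the \<open>2n + 3\<close> cuts of a Carlitz word, or it separates the only two equal neighbours of the word,
  and deleting these and relabelling leaves a cut counted by \<open>s\<^sub>n\<close>; hence
  \<open>s\<^sub>n\<^sub>+\<^sub>1 = (2n + 3) c\<^sub>n\<^sub>+\<^sub>1 + s\<^sub>n\<close>. Eliminating \<open>s\<close> gives the recurrence.
\<close>

subsection \<open>Restricted growth\<close>

fun restricted_growth :: "nat \<Rightarrow> nat list \<Rightarrow> bool" where
  "restricted_growth m [] \<longleftrightarrow> True"
| "restricted_growth m (x # w) \<longleftrightarrow> x \<in> {1..Suc m} \<and> restricted_growth (max m x) w"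

lemma restricted_growth_iff_prefixes:
  "restricted_growth m w \<longleftrightarrow> (\<forall>j. \<exists>k. {1..m} \<union> set (take j w) = {1..k})"
proof (induction w arbitrary: m)
  case Nil
  then show ?case by auto
next
  case (Cons x w)
  let ?interval = "\<lambda>j. \<exists>k. {1..m} \<union> set (take j (x # w)) = {1..k}"
  show ?case
  proof (cases "x \<in> {1..Suc m}")
    case True
    then have "{1..m} \<union> insert x A = {1..max m x} \<union> A" for A
      by (auto simp: max_def)
    then have "(\<forall>j. ?interval (Suc j)) \<longleftrightarrow> restricted_growth (max m x) w"
      by (simp only: Cons.IH take_Suc_Cons set_simps)
    moreover have "?interval 0" by auto
    ultimately show ?thesis
      using True by (metis not0_implies_Suc restricted_growth.simps(2))
  next
    case False
    have "\<not> ?interval 1"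
    proof
      assume "?interval 1"
      then obtain k where interval: "insert x {1..m} = {1..k}" by auto
      then have "x \<in> {1..k}" by blast
      with False have "Suc m \<in> {1..k}" by auto
      with interval have "Suc m \<in> insert x {1..m}" by blast
      with False show False by auto
    qed
    moreover have "\<not> restricted_growth m (x # w)"
      using False restricted_growth.simps(2) by blast
    ultimately show ?thesis by blast
  qed
qed

lemma set_restricted_growth:
  assumes "restricted_growth 0 w"
  shows "set w = {1..card (set w)}"
proof -
  obtain k where "set w = {1..k}"
    using assms[unfolded restricted_growth_iff_prefixes, rule_format, of "length w"] by auto
  then show ?thesis by simp
qed

lemma restricted_growth_append:
  "restricted_growth m (u @ v) \<longleftrightarrow>
     restricted_growth m u \<and> restricted_growth (card ({1..m} \<union> set u)) v"
proof (induction u arbitrary: m)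
  case (Cons x u)
  have "{1..m} \<union> set (x # u) = {1..max m x} \<union> set u" if "x \<in> {1..Suc m}"
    using that by (auto simp: max_def)
  then show ?case by (auto simp: Cons.IH simp del: set_simps)
qed simp

lemma
  assumes "x \<in> set w"
  shows first_occ_less_length: "first_occ w x < length w"
    and nth_first_occ: "w ! first_occ w x = x"
proof -
  have "\<exists>j. j < length w \<and> w ! j = x"
    using assms by (simp add: in_set_conv_nth)
  then have "first_occ w x < length w \<and> w ! first_occ w x = x"
    unfolding first_occ_def by (rule LeastI_ex)
  then show "first_occ w x < length w" "w ! first_occ w x = x" by auto
qed

lemma first_occ_less_iff:
  assumes "x \<in> set w"
  shows "first_occ w x < j \<longleftrightarrow> x \<in> set (take j w)"
proof
  assume "first_occ w x < j"
  then show "x \<in> set (take j w)"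
    using first_occ_less_length[OF assms] nth_first_occ[OF assms]
    by (auto simp: in_set_conv_nth)
next
  assume "x \<in> set (take j w)"
  then obtain i where "i < j" "i < length w" "w ! i = x"
    by (auto simp: in_set_conv_nth)
  moreover from this have "first_occ w x \<le> i"
    unfolding first_occ_def by (intro Least_le) simp
  ultimately show "first_occ w x < j" by simp
qed

lemma first_occ_less_first_occ_iff:
  assumes "x \<in> set w" "y \<in> set w" "x \<noteq> y"
  shows "first_occ w x < first_occ w y \<longleftrightarrow> (\<forall>j. y \<in> set (take j w) \<longrightarrow> x \<in> set (take j w))"
proof -
  have "first_occ w x \<noteq> first_occ w y"
    using assms nth_first_occ by metis
  then have "first_occ w x < first_occ w y \<longleftrightarrow> first_occ w x \<le> first_occ w y"
    by (simp add: le_less)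
  also have "\<dots> \<longleftrightarrow> (\<forall>j. first_occ w y < j \<longrightarrow> first_occ w x < j)"
    by (metis le_less_trans lessI less_Suc_eq_le)
  finally show ?thesis
    using assms by (simp only: first_occ_less_iff)
qed

lemma eq_interval_iff_down_closed:
  fixes A :: "nat set"
  assumes "finite A" "0 \<notin> A"
  shows "(\<exists>m. A = {1..m}) \<longleftrightarrow> (\<forall>i\<ge>1. Suc i \<in> A \<longrightarrow> i \<in> A)"
proof
  assume down: "\<forall>i\<ge>1. Suc i \<in> A \<longrightarrow> i \<in> A"
  define m where "m = Max (insert 0 A)"
  have m: "m \<in> insert 0 A"
    unfolding m_def using assms(1) by (intro Max_in) auto
  have "i \<in> A" if "i \<le> m" "1 \<le> i" for i
    using that
  proof (induction rule: inc_induct)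
    case base
    then show ?case using m by auto
  next
    case (step i)
    then have "Suc i \<in> A" by simp
    with step.prems down show ?case by blast
  qed
  moreover have "i \<le> m" if "i \<in> A" for i
    using that assms(1) by (simp add: m_def)
  ultimately have "A = {1..m}"
    using assms(2) by (auto simp: Suc_le_eq intro: gr0I)
  then show "\<exists>m. A = {1..m}" ..
qed auto

lemma ordered_word_iff_restricted_growth:
  assumes "set w = {1..n}"
  shows "ordered_word n w \<longleftrightarrow> restricted_growth 0 w"
proof -
  have prefix: "set (take j w) \<subseteq> {1..n}" for j
    using assms set_take_subset by metis
  have "ordered_word n w \<longleftrightarrow>
      (\<forall>i. 1 \<le> i \<and> i < n \<longrightarrow> (\<forall>j. Suc i \<in> set (take j w) \<longrightarrow> i \<in> set (take j w)))"
    using assms by (auto simp: ordered_word_def first_occ_less_first_occ_iff)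
  also have "\<dots> \<longleftrightarrow> (\<forall>j. \<forall>i\<ge>1. Suc i \<in> set (take j w) \<longrightarrow> i \<in> set (take j w))"
    using prefix by (meson Suc_le_lessD atLeastAtMost_iff subsetD)
  also have "\<dots> \<longleftrightarrow> (\<forall>j. \<exists>m. set (take j w) = {1..m})"
    using prefix by (subst eq_interval_iff_down_closed) force+
  also have "\<dots> \<longleftrightarrow> restricted_growth 0 w"
    by (simp add: restricted_growth_iff_prefixes)
  finally show ?thesis .
qed

definition ordered_words :: "nat \<Rightarrow> nat \<Rightarrow> nat list set" where
  "ordered_words k n = {w \<in> multiperm_words k n. ordered_word n w}"

lemma ordered_words_iff:
  assumes "k > 0"
  shows "w \<in> ordered_words k n \<longleftrightarrow>
    length w = k * n \<and> (\<forall>i\<in>set w. count_list w i = k) \<and> restricted_growth 0 w"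
proof
  assume w: "w \<in> ordered_words k n"
  then have "i \<in> set w" if "i \<in> {1..n}" for i
    using that assms count_list_0_iff[of w i]
    by (auto simp: ordered_words_def multiperm_words_def)
  with w have "set w = {1..n}"
    by (auto simp: ordered_words_def multiperm_words_def)
  with w show "length w = k * n \<and> (\<forall>i\<in>set w. count_list w i = k) \<and> restricted_growth 0 w"
    by (auto simp: ordered_words_def multiperm_words_def ordered_word_iff_restricted_growth)
next
  assume w: "length w = k * n \<and> (\<forall>i\<in>set w. count_list w i = k) \<and> restricted_growth 0 w"
  have "k * n = length w" using w by simp
  also have "\<dots> = (\<Sum>i\<in>set w. count_list w i)"
    by (rule sum_count_set[symmetric]) auto
  also have "\<dots> = (\<Sum>i\<in>set w. k)"
    using w by (intro sum.cong) auto
  finally have "n = card (set w)"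
    using assms by simp
  with w have "set w = {1..n}"
    using set_restricted_growth by blast
  with w show "w \<in> ordered_words k n"
    by (simp add: ordered_words_def multiperm_words_def ordered_word_iff_restricted_growth)
qed

lemma finite_ordered_words: "finite (ordered_words k n)"
proof (rule finite_subset)
  show "ordered_words k n \<subseteq> {w. set w \<subseteq> {1..n} \<and> length w = k * n}"
    by (auto simp: ordered_words_def multiperm_words_def)
qed (simp add: finite_lists_length_eq)

lemma ordered_carlitz_words_iff:
  "w \<in> ordered_carlitz_words k n \<longleftrightarrow> w \<in> ordered_words k n \<and> distinct_adj w"
  by (auto simp: ordered_carlitz_words_def ordered_words_def)

subsection \<open>Inserting a new letter\<close>

definition skip :: "nat \<Rightarrow> nat \<Rightarrow> nat" where
  "skip a y = (if y < a then y else Suc y)"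

lemma inj_skip: "inj (skip a)"
  by (auto simp: inj_def skip_def split: if_splits)

lemma range_skip: "range (skip a) = - {a}"
proof (intro equalityI subsetI)
  fix y assume "y \<in> - {a}"
  then have "y = skip a (if y < a then y else y - 1)"
    by (auto simp: skip_def)
  then show "y \<in> range (skip a)" by blast
qed (auto simp: skip_def)

lemma map_skip_eq_self:
  assumes "\<And>x. x \<in> set w \<Longrightarrow> x < a"
  shows "map (skip a) w = w"
  using assms by (simp add: skip_def map_idI)

lemma notin_set_map_skip: "a \<notin> set (map (skip a) w)"
  using range_skip[of a] by auto

lemma ex_eq_map_skip:
  assumes "a \<notin> set w"
  obtains w' where "w = map (skip a) w'"
proof -
  have "\<exists>y. x = skip a y" if "x \<in> set w" for x
    using that assms range_skip[of a] by (metis ComplI image_iff singletonD)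
  then show ?thesis using that by (metis ex_map_conv)
qed

lemma distinct_adj_map_skip: "distinct_adj (map (skip a) w) \<longleftrightarrow> distinct_adj w"
  by (simp add: distinct_adj_map_iff inj_on_subset[OF inj_skip])

lemma distinct_adj_Cons_notin: "a \<notin> set w \<Longrightarrow> distinct_adj (a # w) \<longleftrightarrow> distinct_adj w"
  by (cases w) auto

lemma distinct_adj_snoc_notin: "a \<notin> set w \<Longrightarrow> distinct_adj (w @ [a]) \<longleftrightarrow> distinct_adj w"
  by (cases w rule: rev_cases) (auto simp: distinct_adj_append_iff)

lemma distinct_adj_insert_twice:
  assumes "a \<notin> set u" "a \<notin> set v"
  shows "distinct_adj (a # u @ a # v) \<longleftrightarrow> u \<noteq> [] \<and> distinct_adj u \<and> distinct_adj v"
proof (cases "u = []")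
  case False
  then have "last u \<noteq> a" using assms(1) last_in_set by metis
  then show ?thesis
    using False assms distinct_adj_append_iff[of "a # u" "a # v"]
    by (simp add: distinct_adj_Cons_notin)
qed simp

lemma max_skip: "a \<le> Suc m \<Longrightarrow> max (Suc m) (skip a x) = Suc (max m x)"
  by (simp add: skip_def max_def)

lemma skip_in_interval_iff:
  "1 \<le> a \<Longrightarrow> a \<le> Suc m \<Longrightarrow> skip a x \<in> {1..Suc (Suc m)} \<longleftrightarrow> x \<in> {1..Suc m}"
  by (auto simp: skip_def)

lemma restricted_growth_map_skip:
  assumes "1 \<le> a" "a \<le> Suc m"
  shows "restricted_growth (Suc m) (map (skip a) w) \<longleftrightarrow> restricted_growth m w"
  using assms(2)
proof (induction w arbitrary: m)
  case (Cons x w)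
  then show ?case
    using skip_in_interval_iff[OF assms(1) Cons.prems] by (simp add: max_skip)
qed simp

lemma restricted_growth_insert_skip:
  assumes "1 \<le> a" "a \<le> Suc m"
  shows "restricted_growth (Suc m) (map (skip a) v @ a # map (skip a) w) \<longleftrightarrow>
    restricted_growth m (v @ w)"
  using assms(2)
proof (induction v arbitrary: m)
  case Nil
  then show ?case using assms(1) by (simp add: restricted_growth_map_skip max_absorb1)
next
  case (Cons x v)
  then show ?case
    using skip_in_interval_iff[OF assms(1) Cons.prems] by (simp add: max_skip)
qed

lemma count_list_insert_twice:
  fixes u v w :: "'a list"
  assumes "inj f" "a \<notin> range f"
  defines "W \<equiv> map f u @ a # map f v @ a # map f w"
  shows "(\<forall>i\<in>set W. count_list W i = 2) \<longleftrightarrow> (\<forall>i\<in>set (u @ v @ w). count_list (u @ v @ w) i = 2)"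
proof -
  have "set W = insert a (f ` set (u @ v @ w))"
    by (auto simp: W_def)
  moreover have "a \<notin> set (map f x)" for x
    using assms(2) by auto
  then have "count_list W a = 2"
    by (simp add: W_def del: set_map)
  moreover have "count_list W (f i) = count_list (u @ v @ w) i" for i
    using assms(2) by (auto simp: W_def count_list_map_conv[OF assms(1)])
  ultimately show ?thesis by simp
qed

definition next_letter :: "nat list \<Rightarrow> nat" where
  "next_letter u = Suc (card (set u))"

lemma less_next_letter:
  assumes "restricted_growth 0 u" "x \<in> set u"
  shows "x < next_letter u"
  using assms set_restricted_growth
  by (metis atLeastAtMost_iff less_Suc_eq_le next_letter_def)

lemma insert_next_letter_in_ordered_words_iff:
  assumes "restricted_growth 0 u" "a = next_letter u"
  shows "u @ a # map (skip a) v @ a # map (skip a) w \<in> ordered_words 2 (Suc n) \<longleftrightarrow>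
    u @ v @ w \<in> ordered_words 2 n"
proof -
  let ?W = "u @ a # map (skip a) v @ a # map (skip a) w"
  have "map (skip a) u = u"
    using less_next_letter assms by (intro map_skip_eq_self) simp
  moreover have "a \<notin> range (skip a)" by (simp add: range_skip)
  ultimately have "(\<forall>i\<in>set ?W. count_list ?W i = 2) \<longleftrightarrow>
      (\<forall>i\<in>set (u @ v @ w). count_list (u @ v @ w) i = 2)"
    using count_list_insert_twice[OF inj_skip, of a a u v w] by simp
  moreover have "restricted_growth 0 ?W \<longleftrightarrow> restricted_growth 0 (u @ v @ w)"
    using assms
    by (simp add: restricted_growth_append[of 0 u] restricted_growth_insert_skip next_letter_def)
  ultimately show ?thesis
    by (simp only: ordered_words_iff zero_less_numeral) auto
qed

lemma notin_if_twice_in_ordered_words: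
  assumes "u @ a # v @ a # w \<in> ordered_words 2 n"
  shows "a \<notin> set u" "a \<notin> set v" "a \<notin> set w"
proof -
  have "count_list (u @ a # v @ a # w) a = 2"
    using assms by (simp add: ordered_words_iff)
  then show "a \<notin> set u" "a \<notin> set v" "a \<notin> set w"
    by (simp_all add: count_list_0_iff)
qed

lemma twice_in_ordered_words_Suc_iff:
  "u @ a # v @ a # w \<in> ordered_words 2 (Suc n) \<longleftrightarrow>
     a = next_letter u \<and>
     (\<exists>v' w'. v = map (skip a) v' \<and> w = map (skip a) w' \<and> u @ v' @ w' \<in> ordered_words 2 n)"
    (is "?W \<in> _ \<longleftrightarrow> ?R")
proof
  assume W: "?W \<in> ordered_words 2 (Suc n)"
  note notin = notin_if_twice_in_ordered_words[OF W]
  have growth: "restricted_growth 0 u" "restricted_growth (card (set u)) (a # v @ a # w)"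
    using W by (simp_all add: ordered_words_iff restricted_growth_append[of 0 u]
        del: restricted_growth.simps)
  have "a \<notin> {1..card (set u)}"
    using notin(1) set_restricted_growth[OF growth(1)] by blast
  with growth(2) have a: "a = next_letter u"
    by (auto simp: next_letter_def)
  obtain v' w' where "v = map (skip a) v'" "w = map (skip a) w'"
    using notin by (metis ex_eq_map_skip)
  with W a growth(1) show ?R
    using insert_next_letter_in_ordered_words_iff by blast
next
  assume ?R
  then obtain v' w' where "a = next_letter u" "v = map (skip a) v'" "w = map (skip a) w'"
    and uvw: "u @ v' @ w' \<in> ordered_words 2 n"
    by blast
  moreover have "restricted_growth 0 u"
    using uvw by (simp add: ordered_words_iff restricted_growth_append)
  ultimately show "?W \<in> ordered_words 2 (Suc n)"
    by (simp add: insert_next_letter_in_ordered_words_iff)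
qed

definition insert_first :: "nat list \<Rightarrow> nat list \<Rightarrow> nat list" where
  "insert_first u v = 1 # map (skip 1) u @ 1 # map (skip 1) v"

lemma insert_first_inject: "insert_first u v = insert_first u' v' \<longleftrightarrow> u = u' \<and> v = v'"
  by (simp add: insert_first_def append_Cons_eq_iff notin_set_map_skip inj_map_eq_map inj_skip
      del: set_map)

lemma distinct_adj_insert_first:
  "distinct_adj (insert_first u v) \<longleftrightarrow> u \<noteq> [] \<and> distinct_adj u \<and> distinct_adj v"
  unfolding insert_first_def distinct_adj_insert_twice[OF notin_set_map_skip notin_set_map_skip]
  by (simp add: distinct_adj_map_skip)

lemma insert_first_in_ordered_words_iff:
  "insert_first u v \<in> ordered_words 2 (Suc n) \<longleftrightarrow> u @ v \<in> ordered_words 2 n"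
  using insert_next_letter_in_ordered_words_iff[of "[]" 1 u v n]
  by (simp add: insert_first_def next_letter_def)

lemma ordered_words_SucE:
  assumes "w \<in> ordered_words 2 (Suc n)"
  obtains u v where "w = insert_first u v"
proof -
  obtain a w' where w: "w = a # w'"
    using assms by (cases w) (auto simp: ordered_words_iff)
  have "\<forall>i\<in>set w. count_list w i = 2"
    using assms by (simp add: ordered_words_iff)
  then have "count_list w' a = 1" by (simp add: w)
  then have "a \<in> set w'"
    using count_list_0_iff[of w' a] by auto
  then obtain x y where "w' = x @ a # y"
    by (meson split_list)
  then show ?thesis
    using that assms twice_in_ordered_words_Suc_iff[of "[]" a x y n]
    by (auto simp: w next_letter_def insert_first_def)
qed

subsection \<open>Carlitz cuts\<close>

definition cuts :: "'a list set \<Rightarrow> ('a list \<times> 'a list) set" where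
  "cuts A = {(u, v). u @ v \<in> A}"

lemma finite_cuts:
  assumes "finite A"
  shows "finite (cuts A)"
proof (rule finite_subset)
  show "cuts A \<subseteq> (\<Union>w\<in>A. (\<lambda>j. (take j w, drop j w)) ` {..length w})"
  proof (rule subrelI)
    fix u v assume "(u, v) \<in> cuts A"
    then have "u @ v \<in> A" by (simp add: cuts_def)
    moreover have "(u, v) \<in> (\<lambda>j. (take j (u @ v), drop j (u @ v))) ` {..length (u @ v)}"
      by (rule image_eqI[of _ _ "length u"]) auto
    ultimately show "(u, v) \<in> (\<Union>w\<in>A. (\<lambda>j. (take j w, drop j w)) ` {..length w})"
      by blast
  qed
qed (use assms in simp)

lemma card_cuts:
  assumes "\<And>w. w \<in> A \<Longrightarrow> length w = l"
  shows "card (cuts A) = Suc l * card A"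
proof -
  have "bij_betw (\<lambda>(u, v). (u @ v, length u)) (cuts A) (A \<times> {..l})"
  proof (rule bij_betw_byWitness[where f' = "\<lambda>(w, j). (take j w, drop j w)"])
  qed (auto simp: cuts_def min_def dest: assms)
  then show ?thesis
    using bij_betw_same_card by (fastforce simp: card_cartesian_product)
qed

definition carlitz_cuts :: "nat \<Rightarrow> (nat list \<times> nat list) set" where
  "carlitz_cuts n = {(u, v) \<in> cuts (ordered_words 2 n). distinct_adj u \<and> distinct_adj v}"

lemma finite_carlitz_cuts: "finite (carlitz_cuts n)"
  using finite_cuts[OF finite_ordered_words, of 2 n]
  by (rule rev_finite_subset) (auto simp: carlitz_cuts_def)

lemma bij_betw_carlitz_cuts_Nil:
  "bij_betw (\<lambda>w. ([], w)) (ordered_carlitz_words 2 n) {(u, v) \<in> carlitz_cuts n. u = []}"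
  by (auto simp: bij_betw_def inj_on_def carlitz_cuts_def cuts_def ordered_carlitz_words_iff)

lemma bij_betw_carlitz_cuts_Cons:
  "bij_betw (\<lambda>(u, v). insert_first u v)
     {(u, v) \<in> carlitz_cuts n. u \<noteq> []} (ordered_carlitz_words 2 (Suc n))"
  (is "bij_betw ?f ?A ?B")
proof (rule bij_betw_imageI)
  show "inj_on ?f ?A"
    by (auto simp: inj_on_def insert_first_inject)
  have insert_first_iff: "insert_first u v \<in> ?B \<longleftrightarrow> (u, v) \<in> ?A" for u v
    by (auto simp: ordered_carlitz_words_iff carlitz_cuts_def cuts_def
        insert_first_in_ordered_words_iff distinct_adj_insert_first)
  show "?f ` ?A = ?B"
  proof (intro equalityI subsetI)
    fix w assume w: "w \<in> ?B"
    then obtain u v where "w = insert_first u v"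
      by (auto simp: ordered_carlitz_words_iff elim: ordered_words_SucE)
    with w show "w \<in> ?f ` ?A"
      by (force simp: insert_first_iff)
  qed (use insert_first_iff in auto)
qed

lemma adjacent_in_carlitz_cuts_Suc_iff:
  "(u @ [a], a # v) \<in> carlitz_cuts (Suc n) \<longleftrightarrow>
     a = next_letter u \<and> (\<exists>w. v = map (skip a) w \<and> (u, w) \<in> carlitz_cuts n)"
proof -
  have distinct_adj_ends:
    "distinct_adj (u @ [a]) \<longleftrightarrow> distinct_adj u" "distinct_adj (a # v) \<longleftrightarrow> distinct_adj v"
    if "u @ a # [] @ a # v \<in> ordered_words 2 (Suc n)"
    using notin_if_twice_in_ordered_words[OF that]
    by (simp_all add: distinct_adj_snoc_notin distinct_adj_Cons_notin)
  have "(u @ [a], a # v) \<in> carlitz_cuts (Suc n) \<longleftrightarrow>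
      u @ a # [] @ a # v \<in> ordered_words 2 (Suc n) \<and> distinct_adj (u @ [a]) \<and> distinct_adj (a # v)"
    by (simp add: carlitz_cuts_def cuts_def)
  also have "\<dots> \<longleftrightarrow>
      u @ a # [] @ a # v \<in> ordered_words 2 (Suc n) \<and> distinct_adj u \<and> distinct_adj v"
    by (simp only: distinct_adj_ends cong: conj_cong)
  also have "\<dots> \<longleftrightarrow> a = next_letter u \<and> (\<exists>w. v = map (skip a) w \<and> (u, w) \<in> carlitz_cuts n)"
    unfolding twice_in_ordered_words_Suc_iff
    by (auto simp: carlitz_cuts_def cuts_def distinct_adj_map_skip)
  finally show ?thesis .
qed

lemma bij_betw_carlitz_cuts_adjacent:
  "bij_betw (\<lambda>(u, v). (u @ [next_letter u], next_letter u # map (skip (next_letter u)) v))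
     (carlitz_cuts n) {(u, v) \<in> carlitz_cuts (Suc n). \<not> distinct_adj (u @ v)}"
  (is "bij_betw ?f ?A ?B")
proof (rule bij_betw_imageI)
  show "inj_on ?f ?A"
    by (rule inj_onI) (auto simp: inj_map_eq_map inj_skip)
  show "?f ` ?A = ?B"
  proof (intro equalityI subsetI)
    fix c assume "c \<in> ?f ` ?A"
    then show "c \<in> ?B"
      by (auto simp: adjacent_in_carlitz_cuts_Suc_iff distinct_adj_append_iff)
  next
    fix c assume c: "c \<in> ?B"
    then obtain u v where "c = (u, v)" "u \<noteq> []" "v \<noteq> []" "last u = hd v"
      by (auto simp: carlitz_cuts_def distinct_adj_append_iff)
    then obtain x a y where c_eq: "c = (x @ [a], a # y)"
      by (metis append_butlast_last_id list.collapse)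
    with c obtain w where "a = next_letter x" "y = map (skip a) w" "(x, w) \<in> ?A"
      by (auto simp: adjacent_in_carlitz_cuts_Suc_iff)
    then show "c \<in> ?f ` ?A"
      by (intro rev_image_eqI[of "(x, w)"]) (simp_all add: c_eq)
  qed
qed

lemma card_carlitz_cuts:
  "card (carlitz_cuts n) = card (ordered_carlitz_words 2 n) + card (ordered_carlitz_words 2 (Suc n))"
proof -
  let ?Nil = "{(u, v) \<in> carlitz_cuts n. u = []}" and ?Cons = "{(u, v) \<in> carlitz_cuts n. u \<noteq> []}"
  have "carlitz_cuts n = ?Nil \<union> ?Cons" by auto
  then have "card (carlitz_cuts n) = card (?Nil \<union> ?Cons)" by (rule arg_cong)
  also have "\<dots> = card ?Nil + card ?Cons"
    using finite_carlitz_cuts[of n] by (intro card_Un_disjoint) (auto elim: rev_finite_subset)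
  also have "card ?Nil = card (ordered_carlitz_words 2 n)"
    by (rule bij_betw_same_card[OF bij_betw_carlitz_cuts_Nil, symmetric])
  also have "card ?Cons = card (ordered_carlitz_words 2 (Suc n))"
    by (rule bij_betw_same_card[OF bij_betw_carlitz_cuts_Cons])
  finally show ?thesis .
qed

lemma card_carlitz_cuts_Suc:
  "card (carlitz_cuts (Suc n)) =
     (2 * n + 3) * card (ordered_carlitz_words 2 (Suc n)) + card (carlitz_cuts n)"
proof -
  let ?carlitz = "cuts (ordered_carlitz_words 2 (Suc n))"
    and ?adjacent = "{(u, v) \<in> carlitz_cuts (Suc n). \<not> distinct_adj (u @ v)}"
  have "carlitz_cuts (Suc n) = ?carlitz \<union> ?adjacent"
    by (auto simp: carlitz_cuts_def cuts_def ordered_carlitz_words_iff)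
  then have "card (carlitz_cuts (Suc n)) = card (?carlitz \<union> ?adjacent)" by (rule arg_cong)
  also have "\<dots> = card ?carlitz + card ?adjacent"
  proof (rule card_Un_disjoint)
    show "finite ?carlitz"
      by (intro finite_cuts finite_ordered_carlitz_words)
    show "finite ?adjacent"
      using finite_carlitz_cuts by (rule rev_finite_subset) auto
  qed (auto simp: cuts_def ordered_carlitz_words_iff)
  also have "card ?carlitz = Suc (2 * Suc n) * card (ordered_carlitz_words 2 (Suc n))"
    by (rule card_cuts) (simp add: ordered_carlitz_words_iff ordered_words_iff)
  also have "card ?adjacent = card (carlitz_cuts n)"
    by (rule bij_betw_same_card[OF bij_betw_carlitz_cuts_adjacent, symmetric])
  finally show ?thesis by (simp add: eval_nat_numeral)
qed

lemma carlitz_cuts_0: "carlitz_cuts 0 = {([], [])}"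
  by (auto simp: carlitz_cuts_def cuts_def ordered_words_iff)

lemma ordered_carlitz_words_0: "ordered_carlitz_words k 0 = {[]}"
  by (auto simp: ordered_carlitz_words_def multiperm_words_def ordered_word_def)

lemma ordered_carlitz_words_1: "ordered_carlitz_words 2 1 = {}"
  using card_carlitz_cuts[of 0]
  by (simp add: carlitz_cuts_0 ordered_carlitz_words_0 finite_ordered_carlitz_words)

lemma card_ordered_carlitz_words_Suc_Suc:
  "card (ordered_carlitz_words 2 (Suc (Suc n))) =
     (2 * n + 3) * card (ordered_carlitz_words 2 (Suc n)) + card (ordered_carlitz_words 2 n)"
  using card_carlitz_cuts_Suc[of n] by (simp add: card_carlitz_cuts)

theorem theorem3p1:
  fixes p :: "nat \<Rightarrow> nat"
  assumes "p 0 = 1"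
    and "p 1 = 0"
    and "\<And>n. n \<ge> 1 \<Longrightarrow> p (n + 1) = (2 * n + 1) * p n + p (n - 1)"
  shows "\<forall>n. p n = card (ordered_carlitz_words 2 n)"
proof
  fix n
  show "p n = card (ordered_carlitz_words 2 n)"
  proof (induction n rule: induct_nat_012)
    case 0
    show ?case using assms(1) by (simp add: ordered_carlitz_words_0)
  next
    case 1
    show ?case using assms(2) ordered_carlitz_words_1 by simp
  next
    case (ge2 n)
    have "p (Suc (Suc n)) = (2 * n + 3) * p (Suc n) + p n"
      using assms(3)[of "Suc n"] by (simp add: eval_nat_numeral)
    then show ?case
      by (simp only: ge2 card_ordered_carlitz_words_Suc_Suc)
  qed
qed

end
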